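(* If $G$ is a graph with no isolated vertex, then for any graph $H$, $$\gamma_r(G\circ H)\le 2\gamma_t(G).$$
   Context: Graphs are finite, simple and undirected. For a graph $G$, a function $f:V(G)\to\{0,1,2\}$ has weight $w(f)=\sum_{v\in V(G)}f(v)$; a vertex $v$ is undefended with respect to $f$ if $f(v)=0$ and $f(u)=0$ for every $u$ adjacent to $v$. The function $f$ is a weak Roman dominating function (WRDF) on $G$ if for every $v$ with $f(v)=0$ there is a vertex $u$ adjacent to $v$ with $f(u)\in\{1,2\}$ such that the function $f'$ defined by $f'(v)=1$, $f'(u)=f(u)-1$ and $f'(z)=f(z)$ for $z\notin\{u,v\}$ has no undefended vertices. The weak Roman domination number $\gamma_r(G)$ is the minimum weight of a WRDF on $G$. The lexicographic product $G\circ H$ has vertex set $V(G)\times V(H)$, and $(u,v)$ and $(x,y)$ are adjacent iff $ux\in E(G)$, or $u=x$ and $vy\in E(H)$. For a graph $G$ with no isolated vertex, a total dominating set is a set $S\subseteq V(G)$ such that every vertex of $G$ is adjacent to at least one vertex of $S$; $\gamma_t(G)$ is the minimum cardinality of a total dominating set. *)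

theory Defs
  imports "Graph_Theory.Pair_Digraph"
begin

text \<open>
  A finite simple undirected graph is a \<open>pair_graph\<close>: a finite loopfree digraph whose arc relation
  is symmetric, an edge \<open>uv\<close> being the two arcs \<open>(u, v)\<close> and \<open>(v, u)\<close>.
\<close>

definition undefended :: "'a pair_pre_digraph \<Rightarrow> ('a \<Rightarrow> nat) \<Rightarrow> 'a \<Rightarrow> bool" where
  "undefended G f v \<longleftrightarrow>
     v \<in> pverts G \<and> f v = 0 \<and> (\<forall>u. (v, u) \<in> parcs G \<longrightarrow> f u = 0)"

definition weight :: "'a pair_pre_digraph \<Rightarrow> ('a \<Rightarrow> nat) \<Rightarrow> nat" where
  "weight G f = (\<Sum>v\<in>pverts G. f v)"

text \<open>
  The values of \<open>f\<close> outside \<open>pverts G\<close> are irrelevant. The subtraction does not truncate, because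
  \<open>f u \<in> {1, 2}\<close>, and the order of the two updates is immaterial, because \<open>u \<noteq> v\<close>.
\<close>

definition weak_roman_dominating :: "'a pair_pre_digraph \<Rightarrow> ('a \<Rightarrow> nat) \<Rightarrow> bool" where
  "weak_roman_dominating G f \<longleftrightarrow>
     f \<in> pverts G \<rightarrow> {0, 1, 2} \<and>
     (\<forall>v \<in> pverts G. f v = 0 \<longrightarrow>
        (\<exists>u. (v, u) \<in> parcs G \<and> f u \<in> {1, 2} \<and>
             \<not> (\<exists>z. undefended G (f(v := 1, u := f u - 1)) z)))"

definition weak_roman_domination_number :: "'a pair_pre_digraph \<Rightarrow> nat" where
  "weak_roman_domination_number G =
     (LEAST n. \<exists>f. weak_roman_dominating G f \<and> weight G f = n)"

definition lexicographic_product ::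
    "'a pair_pre_digraph \<Rightarrow> 'b pair_pre_digraph \<Rightarrow> ('a \<times> 'b) pair_pre_digraph" where
  "lexicographic_product G H =
     \<lparr> pverts = pverts G \<times> pverts H,
       parcs = {((u, v), (x, y)).
                  u \<in> pverts G \<and> v \<in> pverts H \<and> x \<in> pverts G \<and> y \<in> pverts H \<and>
                  ((u, x) \<in> parcs G \<or> (u = x \<and> (v, y) \<in> parcs H))} \<rparr>"

definition isolated_vertex :: "'a pair_pre_digraph \<Rightarrow> 'a \<Rightarrow> bool" where
  "isolated_vertex G v \<longleftrightarrow> v \<in> pverts G \<and> \<not> (\<exists>u. (v, u) \<in> parcs G)"

definition total_dominating_set :: "'a pair_pre_digraph \<Rightarrow> 'a set \<Rightarrow> bool" where
  "total_dominating_set G S \<longleftrightarrow>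
     S \<subseteq> pverts G \<and> (\<forall>v \<in> pverts G. \<exists>u \<in> S. (v, u) \<in> parcs G)"

text \<open>Only meaningful if no vertex is isolated; otherwise there is no total dominating set.\<close>

definition total_domination_number :: "'a pair_pre_digraph \<Rightarrow> nat" where
  "total_domination_number G = (LEAST n. \<exists>S. total_dominating_set G S \<and> card S = n)"

text \<open>
  The product is again a finite simple graph, and the minima defining the two domination numbers
  are attained.
\<close>

lemma pair_graph_lexicographic_product:
  assumes "pair_graph G" "pair_graph H"
  shows "pair_graph (lexicographic_product G H)"
proof -
  interpret G: pair_graph G by fact
  interpret H: pair_graph H by fact
  let ?P = "lexicographic_product G H"
  have fin: "finite (pverts ?P)"
    by (simp add: lexicographic_product_def)
  have sub: "parcs ?P \<subseteq> pverts ?P \<times> pverts ?P"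
    by (auto simp: lexicographic_product_def)
  show ?thesis
  proof
    show "finite (parcs ?P)"
      using fin sub by (meson finite_SigmaI finite_subset)
    show "symmetric (with_proj ?P)"
      unfolding symmetric_def with_proj_simps lexicographic_product_def sym_def
      by (auto dest: G.arcs_symmetric H.arcs_symmetric)
    show "fst e \<noteq> snd e" if "e \<in> parcs ?P" for e
      using that by (auto simp: lexicographic_product_def dest: G.no_loops' H.no_loops')
  qed (use fin sub in auto)
qed

lemma weak_roman_domination_number_attained:
  "\<exists>f. weak_roman_dominating G f \<and> weight G f = weak_roman_domination_number G"
proof -
  have "weak_roman_dominating G (\<lambda>_. 1)"
    by (auto simp: weak_roman_dominating_def)
  then have "\<exists>n f. weak_roman_dominating G f \<and> weight G f = n"
    by blast
  then show ?thesis
    unfolding weak_roman_domination_number_def by (rule LeastI_ex)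
qed

lemma total_domination_number_attained:
  assumes "pair_graph G" and "\<forall>v. \<not> isolated_vertex G v"
  shows "\<exists>S. total_dominating_set G S \<and> card S = total_domination_number G"
proof -
  interpret pair_graph G by fact
  have "total_dominating_set G (pverts G)"
    using assms(2) by (auto simp: total_dominating_set_def isolated_vertex_def intro: in_arcsD2)
  then have "\<exists>n S. total_dominating_set G S \<and> card S = n"
    by blast
  then show ?thesis
    unfolding total_domination_number_def by (rule LeastI_ex)
qed

end

theory Submission
  imports Defs
begin

text \<open>
  Fix a vertex \<open>h\<close> of \<open>H\<close> and put weight 2 on every vertex of \<open>S \<times> {h}\<close>, where \<open>S\<close> is a total
  dominating set of \<open>G\<close>. Each vertex of the product has a neighbour in \<open>S \<times> {h}\<close>, and after one
  move all of these vertices still carry weight at least 1.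
\<close>

lemma weak_roman_domination_number_le_weight:
  assumes "weak_roman_dominating G f"
  shows "weak_roman_domination_number G \<le> weight G f"
  unfolding weak_roman_domination_number_def using assms by (blast intro: Least_le)

lemma weak_roman_dominating_lexicographic_product:
  assumes S: "total_dominating_set G S" and h: "h \<in> pverts H"
  shows "weak_roman_dominating (lexicographic_product G H) (\<lambda>x. if x \<in> S \<times> {h} then 2 else 0)"
    (is "weak_roman_dominating ?P ?f")
proof -
  \<comment> \<open>For \<open>v = (a, b)\<close> take \<open>(s, h)\<close> with \<open>s\<close>
    in \<open>S\<close> adjacent to \<open>a\<close>: an arc of \<open>G\<close> between first
    coordinates already gives an arc of the product, whatever \<open>b\<close> is.\<close>
  have nbr: "\<exists>u \<in> S \<times> {h}. (v, u) \<in> parcs ?P" if "v \<in> pverts ?P" for v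
    using that S h unfolding total_dominating_set_def lexicographic_product_def by fastforce
  have "\<exists>u. (v, u) \<in> parcs ?P \<and> ?f u \<in> {1, 2} \<and>
          \<not> (\<exists>z. undefended ?P (?f(v := 1, u := ?f u - 1)) z)"
    if v: "v \<in> pverts ?P" for v
  proof -
    obtain u where u: "u \<in> S \<times> {h}" "(v, u) \<in> parcs ?P"
      using nbr[OF v] by blast
    \<comment> \<open>The new value at \<open>x\<close> is 2 - 1 = 1 if \<open>x = u\<close>,
      otherwise 1 if \<open>x = v\<close>, and 2 in all remaining cases.\<close>
    have pos: "(?f(v := 1, u := ?f u - 1)) x \<noteq> 0" if "x \<in> S \<times> {h}" for x
      using that u(1) by simp
    have "\<not> undefended ?P (?f(v := 1, u := ?f u - 1)) z" for z
      using nbr[of z] pos unfolding undefended_def by blast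
    moreover have "?f u \<in> {1, 2}"
      using u(1) by simp
    ultimately show ?thesis
      using u(2) by blast
  qed
  then show ?thesis
    unfolding weak_roman_dominating_def by auto
qed

lemma weight_two_on:
  assumes "finite (pverts G)" "A \<subseteq> pverts G"
  shows "weight G (\<lambda>x. if x \<in> A then 2 else 0) = 2 * card A"
proof -
  have "pverts G \<inter> A = A"
    using assms(2) by blast
  then show ?thesis
    using assms(1) by (simp add: weight_def sum.If_cases)
qed

theorem theorem12:
  fixes G :: "'a pair_pre_digraph" and H :: "'b pair_pre_digraph"
  assumes "pair_graph G" and "pair_graph H"
    and "\<forall>v. \<not> isolated_vertex G v"
  shows "weak_roman_domination_number (lexicographic_product G H)
           \<le> 2 * total_domination_number G"
proof -
  let ?P = "lexicographic_product G H"
  obtain S where S: "total_dominating_set G S" and card: "card S = total_domination_number G"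
    using total_domination_number_attained[OF assms(1,3)] by blast
  show ?thesis
  proof (cases "pverts H = {}")
    \<comment> \<open>There is no \<open>h\<close> to choose, but the product is empty, so the zero
      function is vacuously dominating.\<close>
    case True
    then have "pverts ?P = {}"
      by (simp add: lexicographic_product_def)
    then have "weak_roman_dominating ?P (\<lambda>_. 0)" "weight ?P (\<lambda>_. 0) = 0"
      by (simp_all add: weak_roman_dominating_def weight_def)
    then show ?thesis
      using weak_roman_domination_number_le_weight by fastforce
  next
    case False
    then obtain h where h: "h \<in> pverts H"
      by blast
    \<comment> \<open>This supplies the finiteness of the vertex set of the product; a sum over an
      infinite set would be 0 by default.\<close>
    interpret P: pair_graph ?P
      using assms(1,2) by (rule pair_graph_lexicographic_product)
    have "S \<times> {h} \<subseteq> pverts ?P"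
      using S h by (auto simp: total_dominating_set_def lexicographic_product_def)
    then have "weight ?P (\<lambda>x. if x \<in> S \<times> {h} then 2 else 0) = 2 * card (S \<times> {h})"
      using P.finite_verts by (intro weight_two_on) (simp_all only: with_proj_simps)
    also have "\<dots> = 2 * total_domination_number G"
      by (simp add: card_cartesian_product card)
    finally show ?thesis
      using weak_roman_domination_number_le_weight[OF
          weak_roman_dominating_lexicographic_product[OF S h]] by simp
  qed
qed

end
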